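(* Let $\mathcal{X}$ be an infinite-dimensional separable Banach space over $\mathbb{K}\in\{\mathbb{R},\mathbb{C}\}$, and let $(\{f_k\}_{k\ge 1},\{f_k^*\}_{k\ge 1})$, with $f_k\in\mathcal{X}$ and $f_k^*\in\mathcal{X}^*$, be a reconstruction system for $\mathcal{X}$ such that $\inf_{1\le k<\infty}\|f_k\|>0$. Then $(\{f_k\},\{f_k^*\})$ satisfies property $\mathfrak{I}$ if and only if there is no retro pre-frame operator $\Theta_0$ (with respect to any associated Banach sequence space $\mathcal{Z}_d$) such that $(\{f_k^*-f_{k+1}^*\}_{k\ge 1},\Theta_0)$ is a retro Banach frame for $[f_k^*]^*$, the dual of the closed subspace $[f_k^*]\subset\mathcal{X}^*$.
   Context: For a sequence $\{y_k\}$ in a Banach space, $[y_k]$ denotes the norm closure of its linear span (a Banach space with the inherited norm). Reconstruction system: $(\{f_k\},\{f_k^*\})$ with $f_k\in\mathcal{X}$, $f_k^*\in\mathcal{X}^*$ is a reconstruction system for $\mathcal{X}$ if $f=\sum_{k=1}^\infty f_k^*(f)f_k$ (norm convergence) for every $f\in\mathcal{X}$. Property $\mathfrak{I}$: a reconstruction system $(\{f_k\},\{f_k^*\})$ for $\mathcal{X}$ satisfies property $\mathfrak{I}$ if $\inf_{1\le k<\infty}\|f_k\|>0$ and there exists $\Psi\in\mathcal{X}^{**}$ such that $\Psi(f_k^* )=1$ for all $k\in\mathbb{N}$. Retro Banach frame: let $\mathcal{Y}$ be a Banach space, $\{y_k\}\subset\mathcal{Y}$, let $\mathcal{Z}_d$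 be a Banach space of scalar-valued sequences (indexed by $\mathbb{N}$, with coordinatewise linear operations), and $\Theta:\mathcal{Z}_d\to\mathcal{Y}^*$. The system $(\{y_k\},\Theta)$ is a retro Banach frame for $\mathcal{Y}^*$ with respect to $\mathcal{Z}_d$ if: (i) $\{y^*(y_k)\}\in\mathcal{Z}_d$ for each $y^*\in\mathcal{Y}^*$; (ii) there are constants $0<A_0\le B_0<\infty$ with $A_0\|y^*\|\le\|\{y^*(y_k)\}\|_{\mathcal{Z}_d}\le B_0\|y^*\|$ for each $y^*\in\mathcal{Y}^*$; (iii) $\Theta$ is a bounded linear operator from $\mathcal{Z}_d$ onto $\mathcal{Y}^*$ with $\Theta(\{y^*(y_k)\})=y^*$ for each $y^*\in\mathcal{Y}^*$. Then $\Theta$ is called the retro pre-frame operator. Here this is applied with $\mathcal{Y}=[f_k^*]$ and $y_k=f_k^*-f_{k+1}^*$. *)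

theory Defs
  imports "HOL-Analysis.Analysis" "HOL-Library.Function_Algebras"
begin

section \<open>Scalar fields and Banach spaces over them\<close>

text \<open>
  The two alternatives of the axiom describe the real and the complex field up to isometric
  isomorphism; both types are instances.
\<close>

class real_or_complex = real_normed_field + banach +
  assumes real_or_complex:
    "(\<forall>x. \<exists>a. x = a *\<^sub>R 1) \<or>
     (\<exists>j. j * j = - 1 \<and>
        (\<forall>x. \<exists>a b. x = a *\<^sub>R 1 + b *\<^sub>R j \<and> norm x = sqrt (a\<^sup>2 + b\<^sup>2)))"

instance real :: real_or_complex
  by standard auto

instance complex :: real_or_complex
proof
  have "\<exists>a b. x = a *\<^sub>R 1 + b *\<^sub>R \<i> \<and> norm x = sqrt (a\<^sup>2 + b\<^sup>2)" for x :: complex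
    by (rule exI[of _ "Re x"], rule exI[of _ "Im x"]) (simp add: cmod_def complex_eq_iff)
  then show "(\<forall>x::complex. \<exists>a. x = a *\<^sub>R 1) \<or>
     (\<exists>j::complex. j * j = - 1 \<and>
        (\<forall>x. \<exists>a b. x = a *\<^sub>R 1 + b *\<^sub>R j \<and> norm x = sqrt (a\<^sup>2 + b\<^sup>2)))"
    using i_squared by blast
qed

text \<open>
  The library has no class of complex normed spaces. A normed space over \<open>'k\<close> is a real normed
  space (as a type) together with a scalar multiplication by \<open>'k\<close> that extends the real one and
  is compatible with the norm. Completeness does not depend on the scalars.
\<close>

definition normed_scaling ::
    "('k::real_normed_field \<Rightarrow> 'a::real_normed_vector \<Rightarrow> 'a) \<Rightarrow> bool" where
  "normed_scaling sc \<longleftrightarrow> vector_space sc \<and>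
     (\<forall>r x. sc (of_real r) x = r *\<^sub>R x) \<and>
     (\<forall>c x. norm (sc c x) = norm c * norm x)"

lemma normed_scaling_scaleR: "normed_scaling ((*\<^sub>R) :: real \<Rightarrow> 'a \<Rightarrow> 'a::real_normed_vector)"
  unfolding normed_scaling_def by (simp add: real_vector.vector_space_axioms)

definition infinite_dimensional :: "('k::field \<Rightarrow> 'a::ab_group_add \<Rightarrow> 'a) \<Rightarrow> bool" where
  "infinite_dimensional sc \<longleftrightarrow> \<not> (\<exists>B. finite B \<and> module.span sc B = UNIV)"

definition closed_span ::
    "('k::real_normed_field \<Rightarrow> 'a::real_normed_vector \<Rightarrow> 'a) \<Rightarrow> (nat \<Rightarrow> 'a) \<Rightarrow> 'a set" where
  "closed_span sc y = closure (module.span sc (range y))"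

definition linear_map_on ::
    "('k \<Rightarrow> 'a::plus \<Rightarrow> 'a) \<Rightarrow> ('k \<Rightarrow> 'b::plus \<Rightarrow> 'b) \<Rightarrow> 'a set \<Rightarrow> ('a \<Rightarrow> 'b) \<Rightarrow> bool" where
  "linear_map_on sa sb S F \<longleftrightarrow>
     (\<forall>x\<in>S. \<forall>y\<in>S. F (x + y) = F x + F y) \<and> (\<forall>c. \<forall>x\<in>S. F (sa c x) = sb c (F x))"


section \<open>Dual spaces\<close>

text \<open>
  The dual of a whole space (a type) consists of the \<open>'k\<close>-linear elements of the library's space
  of bounded real-linear maps, with the library's norm (which is the usual dual norm) and
  topology.
\<close>

definition dual_space ::
    "('k::real_normed_field \<Rightarrow> 'a::real_normed_vector \<Rightarrow> 'a) \<Rightarrow> ('a \<Rightarrow>\<^sub>L 'k) set" where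
  "dual_space sc = {\<phi>. \<forall>c x. blinfun_apply \<phi> (sc c x) = c * blinfun_apply \<phi> x}"

definition dual_scale :: "'k::real_normed_field \<Rightarrow> ('a::real_normed_vector \<Rightarrow>\<^sub>L 'k) \<Rightarrow> ('a \<Rightarrow>\<^sub>L 'k)" where
  "dual_scale c \<phi> = blinfun_mult_right c o\<^sub>L \<phi>"

lemma dual_scale_apply [simp]: "blinfun_apply (dual_scale c \<phi>) x = c * blinfun_apply \<phi> x"
  by (simp add: dual_scale_def)

text \<open>
  The dual of a subspace \<open>Y\<close> of a normed space. Functionals on \<open>Y\<close> are represented by functions
  that vanish outside \<open>Y\<close>, so that equality of functions is equality on \<open>Y\<close>, and the pointwise
  operations of \<open>Function_Algebras\<close> are those of the dual.
\<close>

definition dual_on ::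
    "('k::real_normed_field \<Rightarrow> 'b::real_normed_vector \<Rightarrow> 'b) \<Rightarrow> 'b set \<Rightarrow> ('b \<Rightarrow> 'k) set" where
  "dual_on sc Y = {\<phi>. linear_map_on sc (*) Y \<phi> \<and>
     (\<exists>C. \<forall>y\<in>Y. norm (\<phi> y) \<le> C * norm y) \<and> (\<forall>y. y \<notin> Y \<longrightarrow> \<phi> y = 0)}"

definition dual_norm_on :: "'b::real_normed_vector set \<Rightarrow> ('b \<Rightarrow> 'k::real_normed_field) \<Rightarrow> real" where
  "dual_norm_on Y \<phi> = (SUP y\<in>{y\<in>Y. norm y \<le> 1}. norm (\<phi> y))"

definition bidual_space ::
    "('k::real_normed_field \<Rightarrow> 'a::real_normed_vector \<Rightarrow> 'a) \<Rightarrow> (('a \<Rightarrow>\<^sub>L 'k) \<Rightarrow> 'k) set" where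
  "bidual_space sc = dual_on dual_scale (dual_space sc)"

lemma normed_scaling_dual_scale:
  "normed_scaling (dual_scale :: 'k::real_normed_field \<Rightarrow> ('a::real_normed_vector \<Rightarrow>\<^sub>L 'k) \<Rightarrow> _)"
proof -
  have *: "norm (dual_scale c \<phi>) \<le> norm c * norm \<phi>" for c :: 'k and \<phi> :: "'a \<Rightarrow>\<^sub>L 'k"
    by (rule norm_blinfun_bound)
       (auto simp: norm_mult mult.assoc intro!: mult_left_mono norm_blinfun)
  have "norm (dual_scale c \<phi>) = norm c * norm \<phi>" for c :: 'k and \<phi> :: "'a \<Rightarrow>\<^sub>L 'k"
  proof (cases "c = 0")
    case True
    then show ?thesis using *[of c \<phi>] by simp
  next
    case False
    then have "dual_scale (inverse c) (dual_scale c \<phi>) = \<phi>"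
      by (intro blinfun_eqI) (simp add: mult.assoc [symmetric])
    then have "norm \<phi> \<le> norm (inverse c) * norm (dual_scale c \<phi>)"
      using *[of "inverse c" "dual_scale c \<phi>"] by simp
    then have "norm c * norm \<phi> \<le> norm (dual_scale c \<phi>)"
      using False by (simp add: norm_divide field_simps)
    then show ?thesis using *[of c \<phi>] by simp
  qed
  moreover have "vector_space (dual_scale :: 'k \<Rightarrow> ('a \<Rightarrow>\<^sub>L 'k) \<Rightarrow> _)"
    by standard (auto intro!: blinfun_eqI simp: blinfun.add_left algebra_simps)
  moreover have "dual_scale (of_real r) \<phi> = r *\<^sub>R \<phi>" for r and \<phi> :: "'a \<Rightarrow>\<^sub>L 'k"
    by (intro blinfun_eqI) (simp add: blinfun.scaleR_left scaleR_conv_of_real)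
  ultimately show ?thesis
    by (auto simp: normed_scaling_def)
qed

lemma subspace_dual_space:
  fixes sc :: "'k::real_normed_field \<Rightarrow> 'a::real_normed_vector \<Rightarrow> 'a"
  shows "module.subspace dual_scale (dual_space sc)"
proof -
  interpret vector_space "dual_scale :: 'k \<Rightarrow> ('a \<Rightarrow>\<^sub>L 'k) \<Rightarrow> ('a \<Rightarrow>\<^sub>L 'k)"
    by (rule normed_scaling_dual_scale [unfolded normed_scaling_def, THEN conjunct1])
  show ?thesis
    by (auto simp: subspace_def dual_space_def blinfun.add_left algebra_simps)
qed

lemma closed_dual_space: "closed (dual_space sc)"
proof -
  have eq: "dual_space sc =
      (\<Inter>c. \<Inter>x. {\<phi>. blinfun_apply \<phi> (sc c x) = c * blinfun_apply \<phi> x})"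
    by (auto simp: dual_space_def)
  show ?thesis
    unfolding eq by (intro closed_INT ballI closed_Collect_eq continuous_intros)
qed

lemma closed_span_subset_dual_space:
  fixes sc :: "'k::real_normed_field \<Rightarrow> 'a::real_normed_vector \<Rightarrow> 'a"
  assumes "range fs \<subseteq> dual_space sc"
  shows "closed_span dual_scale fs \<subseteq> dual_space sc"
proof -
  interpret vector_space "dual_scale :: 'k \<Rightarrow> ('a \<Rightarrow>\<^sub>L 'k) \<Rightarrow> ('a \<Rightarrow>\<^sub>L 'k)"
    by (rule normed_scaling_dual_scale [unfolded normed_scaling_def, THEN conjunct1])
  show ?thesis
    unfolding closed_span_def
    by (intro closure_minimal closed_dual_space span_minimal assms subspace_dual_space)
qed


section \<open>Reconstruction systems and retro Banach frames\<close>

text \<open>Sequences are indexed by all of \<open>nat\<close>, i.e. from \<open>0\<close> instead of \<open>1\<close>.\<close>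

definition reconstruction_system ::
    "('k::real_normed_field \<Rightarrow> 'a::real_normed_vector \<Rightarrow> 'a) \<Rightarrow> (nat \<Rightarrow> 'a) \<Rightarrow> (nat \<Rightarrow> 'a \<Rightarrow>\<^sub>L 'k) \<Rightarrow> bool" where
  "reconstruction_system sc f fs \<longleftrightarrow>
     (\<forall>k. fs k \<in> dual_space sc) \<and> (\<forall>x. (\<lambda>k. sc (blinfun_apply (fs k) x) (f k)) sums x)"

definition property_I ::
    "('k::real_normed_field \<Rightarrow> 'a::real_normed_vector \<Rightarrow> 'a) \<Rightarrow> (nat \<Rightarrow> 'a) \<Rightarrow> (nat \<Rightarrow> 'a \<Rightarrow>\<^sub>L 'k) \<Rightarrow> bool" where
  "property_I sc f fs \<longleftrightarrow>
     reconstruction_system sc f fs \<and> (INF k. norm (f k)) > 0 \<and>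
     (\<exists>\<Psi>\<in>bidual_space sc. \<forall>k. \<Psi> (fs k) = 1)"

definition seq_scale :: "'k::times \<Rightarrow> ('i \<Rightarrow> 'k) \<Rightarrow> ('i \<Rightarrow> 'k)" where
  "seq_scale c u = (\<lambda>i. c * u i)"

text \<open>
  A Banach space \<open>(Z, N)\<close> of scalar sequences with the coordinatewise linear operations. The
  values of \<open>N\<close> outside \<open>Z\<close> are irrelevant, and no continuity of the coordinate functionals is
  required.
\<close>

definition banach_sequence_space ::
    "(nat \<Rightarrow> 'k::real_normed_field) set \<Rightarrow> ((nat \<Rightarrow> 'k) \<Rightarrow> real) \<Rightarrow> bool" where
  "banach_sequence_space Z N \<longleftrightarrow>
     module.subspace seq_scale Z \<and>
     (\<forall>u\<in>Z. N u \<ge> 0 \<and> (N u = 0 \<longleftrightarrow> u = 0)) \<and>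
     (\<forall>c. \<forall>u\<in>Z. N (seq_scale c u) = norm c * N u) \<and>
     (\<forall>u\<in>Z. \<forall>v\<in>Z. N (u + v) \<le> N u + N v) \<and>
     (\<forall>s. range s \<subseteq> Z \<and> (\<forall>e>0. \<exists>M. \<forall>m\<ge>M. \<forall>n\<ge>M. N (s m - s n) < e)
        \<longrightarrow> (\<exists>u\<in>Z. (\<lambda>n. N (s n - u)) \<longlonglongrightarrow> 0))"

lemma vector_space_seq_scale:
  "vector_space (seq_scale :: 'k::field \<Rightarrow> ('i \<Rightarrow> 'k) \<Rightarrow> ('i \<Rightarrow> 'k))"
  by standard (auto simp: seq_scale_def algebra_simps)

text \<open>
  \<open>(y, \<Theta>)\<close> is a retro Banach frame for the dual of \<open>Y\<close> with respect to \<open>(Z, N)\<close>, where \<open>Y\<close> is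
  a closed subspace of a Banach space.
\<close>

definition retro_banach_frame ::
    "('k::real_normed_field \<Rightarrow> 'b::real_normed_vector \<Rightarrow> 'b) \<Rightarrow> 'b set \<Rightarrow> (nat \<Rightarrow> 'b) \<Rightarrow>
     (nat \<Rightarrow> 'k) set \<Rightarrow> ((nat \<Rightarrow> 'k) \<Rightarrow> real) \<Rightarrow> ((nat \<Rightarrow> 'k) \<Rightarrow> ('b \<Rightarrow> 'k)) \<Rightarrow> bool" where
  "retro_banach_frame sc Y y Z N \<Theta> \<longleftrightarrow>
     (\<forall>k. y k \<in> Y) \<and> banach_sequence_space Z N \<and>
     (\<forall>\<phi>\<in>dual_on sc Y. (\<lambda>k. \<phi> (y k)) \<in> Z) \<and>
     (\<exists>A B. 0 < A \<and> A \<le> B \<and>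
        (\<forall>\<phi>\<in>dual_on sc Y. A * dual_norm_on Y \<phi> \<le> N (\<lambda>k. \<phi> (y k)) \<and>
                         N (\<lambda>k. \<phi> (y k)) \<le> B * dual_norm_on Y \<phi>)) \<and>
     \<Theta> ` Z = dual_on sc Y \<and>
     linear_map_on seq_scale seq_scale Z \<Theta> \<and>
     (\<exists>C. \<forall>u\<in>Z. dual_norm_on Y (\<Theta> u) \<le> C * N u) \<and>
     (\<forall>\<phi>\<in>dual_on sc Y. \<Theta> (\<lambda>k. \<phi> (y k)) = \<phi>)"

end

theory Submission
  imports Defs
begin

text \<open>
  Put \<open>Y = [f\<^sub>k\<^sup>*]\<close> and let \<open>T\<close> send \<open>\<phi> \<in> Y\<^sup>*\<close> to \<open>(\<phi>(f\<^sub>k\<^sup>* - f\<^sub>k\<^sub>+\<^sub>1\<^sup>*))\<^sub>k\<close>. A retro Banach frame exists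
  iff \<open>T\<close> is injective: \<open>\<Theta>\<close> is a left inverse of \<open>T\<close>, and conversely the range of an injective \<open>T\<close>
  is a Banach sequence space for the norm transported from \<open>Y\<^sup>*\<close>. A functional in the kernel of \<open>T\<close>
  is constant on the \<open>f\<^sub>k\<^sup>*\<close>, and if it is nonzero then so is the constant; normalising and extending by
  Hahn--Banach gives \<open>\<Psi>\<close>. Conversely, \<open>\<Psi>\<close> restricted to \<open>Y\<close> is a nonzero element of the kernel.
\<close>

section \<open>The Hahn--Banach theorem\<close>

text \<open>Homogeneity is stated as an inequality for positive scalars, the form that is easiest to
  verify for infima; equality and \<open>p 0 = 0\<close> are consequences.\<close>

definition sublinear :: "('a::real_vector \<Rightarrow> real) \<Rightarrow> bool" where
  "sublinear p \<longleftrightarrow> (\<forall>x y. p (x + y) \<le> p x + p y) \<and> (\<forall>t>0. \<forall>x. p (t *\<^sub>R x) \<le> t * p x)"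

lemma sublinear_add: "sublinear p \<Longrightarrow> p (x + y) \<le> p x + p y"
  by (simp add: sublinear_def)

lemma sublinear_scaleR_le: "sublinear p \<Longrightarrow> 0 < t \<Longrightarrow> p (t *\<^sub>R x) \<le> t * p x"
  by (simp add: sublinear_def)

lemma sublinear_zero:
  assumes "sublinear p"
  shows "p 0 = 0"
  using sublinear_add [OF assms, of 0 0] sublinear_scaleR_le [OF assms, of "1/2" 0] by simp

lemma sublinear_scaleR:
  assumes "sublinear p" "0 \<le> t"
  shows "p (t *\<^sub>R x) = t * p x"
proof (cases "t = 0")
  case True
  then show ?thesis by (simp add: sublinear_zero [OF assms(1)])
next
  case False
  then have t: "0 < t" using assms by simp
  have "p x \<le> inverse t * p (t *\<^sub>R x)"
    using sublinear_scaleR_le [OF assms(1), of "inverse t" "t *\<^sub>R x"] t by simp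
  then have "t * p x \<le> p (t *\<^sub>R x)"
    using t by (simp add: field_simps)
  then show ?thesis
    using sublinear_scaleR_le [OF assms(1) t, of x] by simp
qed

lemma sublinear_minus:
  assumes "sublinear p"
  shows "- p (- x) \<le> p x"
  using sublinear_add [OF assms, of x "- x"] sublinear_zero [OF assms] by simp

text \<open>Infima over \<open>i\<close> and \<open>j\<close> are taken one after the other. The
  witness \<open>k\<close> may depend on everything: for a parametrised family it is the sum or
  multiple of the parameters, for a chain the smaller member. The assumption \<open>bdd\<close>
  makes the real infimum meaningful.\<close>

lemma sublinear_INF:
  assumes ne: "I \<noteq> {}"
    and bdd: "\<And>x. bdd_below ((\<lambda>i. h i x) ` I)"
    and add: "\<And>i j x y. i \<in> I \<Longrightarrow> j \<in> I \<Longrightarrow> \<exists>k\<in>I. h k (x + y) \<le> h i x + h j y"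
    and scale: "\<And>i t x. i \<in> I \<Longrightarrow> 0 < t \<Longrightarrow> \<exists>k\<in>I. h k (t *\<^sub>R x) \<le> t * h i x"
  shows "sublinear (\<lambda>x. INF i\<in>I. h i x :: real)"
  unfolding sublinear_def
proof (intro conjI allI impI)
  fix x y
  let ?q = "\<lambda>x. INF i\<in>I. h i x"
  have "?q (x + y) \<le> h i x + h j y" if ij: "i \<in> I" "j \<in> I" for i j
  proof -
    obtain k where "k \<in> I" "h k (x + y) \<le> h i x + h j y"
      using add [OF ij, of x y] by blast
    then show ?thesis by (intro cINF_lower2 [OF bdd])
  qed
  then have "?q (x + y) - h j y \<le> ?q x" if "j \<in> I" for j
    using that by (intro cINF_greatest [OF ne]) (simp add: diff_le_eq)
  then have "?q (x + y) - ?q x \<le> ?q y"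
    by (intro cINF_greatest [OF ne]) (simp add: algebra_simps)
  then show "?q (x + y) \<le> ?q x + ?q y" by simp
next
  fix t :: real and x
  assume t: "0 < t"
  let ?q = "\<lambda>x. INF i\<in>I. h i x"
  have "?q (t *\<^sub>R x) / t \<le> ?q x"
  proof (rule cINF_greatest [OF ne])
    fix i assume "i \<in> I"
    then obtain k where "k \<in> I" "h k (t *\<^sub>R x) \<le> t * h i x"
      using scale t by blast
    then have "?q (t *\<^sub>R x) \<le> t * h i x" by (intro cINF_lower2 [OF bdd])
    then show "?q (t *\<^sub>R x) / t \<le> h i x" using t by (simp add: field_simps)
  qed
  then show "?q (t *\<^sub>R x) \<le> t * ?q x" using t by (simp add: field_simps)
qed

text \<open>
  Perturbing \<open>p\<close> in a direction \<open>a\<close> to \<open>q x = (INF t\<ge>0. p (x + t a) - t p a)\<close> keeps it sublinear and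
  does not increase it; by minimality \<open>p (- a) = q (- a) \<le> - p a\<close>, so \<open>p\<close> is odd.
\<close>

lemma minimal_sublinear_linear:
  assumes p: "sublinear p"
    and minimal: "\<And>q. sublinear q \<Longrightarrow> q \<le> p \<Longrightarrow> q = p"
  shows "linear p"
proof -
  have odd: "p (- a) = - p a" for a
  proof -
    define h where "h = (\<lambda>t x. p (x + t *\<^sub>R a) - t * p a)"
    define q where "q = (\<lambda>x. INF t\<in>{0..}. h t x)"
    have bdd: "bdd_below ((\<lambda>t. h t x) ` {0..})" for x
    proof (rule bdd_belowI2)
      \<comment> \<open>Writing \<open>t a\<close> as \<open>(x + t a) - x\<close> and using
        \<open>t * p a = p (t a)\<close> gives a lower bound independent of
        \<open>t\<close>.\<close>
      fix t :: real assume "t \<in> {0..}"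
      then show "- p (- x) \<le> h t x"
        using sublinear_add [OF p, of "x + t *\<^sub>R a" "- x"] sublinear_scaleR [OF p, of t a]
        by (simp add: h_def)
    qed
    have "sublinear q"
      unfolding q_def
    proof (rule sublinear_INF [OF _ bdd])
      fix s t :: real and x y
      assume st: "s \<in> {0..}" "t \<in> {0..}"
      have "h (s + t) (x + y) \<le> h s x + h t y"
        using sublinear_add [OF p, of "x + s *\<^sub>R a" "y + t *\<^sub>R a"]
        by (simp add: h_def algebra_simps)
      then show "\<exists>k\<in>{0..}. h k (x + y) \<le> h s x + h t y"
        using st by (intro bexI [of _ "s + t"]) auto
    next
      fix s t :: real and x
      assume s: "s \<in> {0..}" and t: "0 < t"
      have "h (t * s) (t *\<^sub>R x) \<le> t * h s x"
        using sublinear_scaleR_le [OF p t, of "x + s *\<^sub>R a"]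
        by (simp add: h_def algebra_simps)
      then show "\<exists>k\<in>{0..}. h k (t *\<^sub>R x) \<le> t * h s x"
        using s t by (intro bexI [of _ "t * s"]) auto
    qed simp
    moreover have "q \<le> p"
    proof (rule le_funI)
      fix x
      have "q x \<le> h 0 x" unfolding q_def by (rule cINF_lower [OF bdd]) simp
      then show "q x \<le> p x" by (simp add: h_def)
    qed
    ultimately have "q = p" by (rule minimal)
    moreover have "q (- a) \<le> h 1 (- a)"
      unfolding q_def by (rule cINF_lower [OF bdd]) simp
    ultimately have "p (- a) \<le> - p a"
      by (simp add: h_def sublinear_zero [OF p])
    then show ?thesis using sublinear_minus [OF p, of "- a"] by simp
  qed
  show ?thesis
  proof (rule linearI)
    fix x y
    have "p (- x + - y) \<le> p (- x) + p (- y)" by (rule sublinear_add [OF p])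
    then have "p x + p y \<le> p (x + y)"
      using odd [of "x + y"] by (simp add: odd)
    then show "p (x + y) = p x + p y"
      using sublinear_add [OF p, of x y] by simp
  next
    fix t :: real and x
    show "p (t *\<^sub>R x) = t *\<^sub>R p x"
    proof (cases "0 \<le> t")
      case True
      then show ?thesis by (simp add: sublinear_scaleR [OF p])
    next
      case False
      then show ?thesis
        using sublinear_scaleR [OF p, of "- t" x] odd [of "t *\<^sub>R x"] by simp
    qed
  qed
qed

text \<open>Zorn's lemma yields a minimal sublinear functional below \<open>p\<close>, and minimal
  ones are linear. A nonempty chain is bounded below by its pointwise infimum.\<close>

lemma sublinear_dominates_linear:
  fixes p :: "'a::real_vector \<Rightarrow> real"
  assumes p: "sublinear p"
  obtains g where "linear g" "g \<le> p"
proof -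
  define A where "A = {q. sublinear q \<and> q \<le> p}"
  have pA: "p \<in> A" by (simp add: A_def p)
  \<comment> \<open>The order is reversed, so the maximal element provided by Zorn's lemma is a
    minimal functional.\<close>
  have "\<exists>m\<in>A. \<forall>a\<in>A. a \<le> m \<longrightarrow> a = m"
  proof (rule predicate_Zorn)
    show "partial_order_on A (relation_of (\<lambda>a b. b \<le> a) A)"
      by (rule partial_order_on_relation_ofI) auto
  next
    fix C assume C: "C \<in> Chains (relation_of (\<lambda>a b. b \<le> a) A)"
    then have CA: "C \<subseteq> A" by (rule Chains_relation_of)
    have total: "q \<le> r \<or> r \<le> q" if "q \<in> C" "r \<in> C" for q r
      using C that by (auto simp: Chains_def relation_of_def)
    show "\<exists>u\<in>A. \<forall>a\<in>C. u \<le> a"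
    proof (cases "C = {}")
      case True
      then show ?thesis using pA by auto
    next
      case False
      define u where "u = (\<lambda>x. INF q\<in>C. q x)"
      have bdd: "bdd_below ((\<lambda>q. q x) ` C)" for x
      proof (rule bdd_belowI2)
        \<comment> \<open>The bound is uniform over the chain because
          \<open>- p (- x) \<le> - q (- x) \<le> q x\<close>.\<close>
        fix q assume "q \<in> C"
        then have "sublinear q" "q (- x) \<le> p (- x)" using CA by (auto simp: A_def le_fun_def)
        then show "- p (- x) \<le> q x" using sublinear_minus [of q x] by simp
      qed
      have "sublinear u"
        unfolding u_def
      proof (rule sublinear_INF [OF False bdd])
        fix q r x y assume qr: "q \<in> C" "r \<in> C"
        then have add: "q (x + y) \<le> q x + q y" "r (x + y) \<le> r x + r y"
          using CA by (auto simp: A_def sublinear_add)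
        from total [OF qr] show "\<exists>k\<in>C. k (x + y) \<le> q x + r y"
        proof
          assume "q \<le> r"
          then have "q y \<le> r y" by (simp add: le_fun_def)
          then show ?thesis using qr add by (intro bexI [of _ q]) auto
        next
          assume "r \<le> q"
          then have "r x \<le> q x" by (simp add: le_fun_def)
          then show ?thesis using qr add by (intro bexI [of _ r]) auto
        qed
      next
        fix q x and t :: real assume "q \<in> C" "0 < t"
        then show "\<exists>k\<in>C. k (t *\<^sub>R x) \<le> t * q x"
          using CA by (auto simp: A_def intro!: bexI [of _ q] sublinear_scaleR_le)
      qed
      moreover have below: "u \<le> q" if "q \<in> C" for q
        unfolding u_def le_fun_def using that by (auto intro: cINF_lower [OF bdd])
      moreover have "u \<le> p"
      proof -
        obtain q where "q \<in> C" using False by blast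
        then have "u \<le> q" "q \<le> p" using below CA by (auto simp: A_def)
        then show ?thesis by (rule order_trans)
      qed
      ultimately show ?thesis by (auto simp: A_def)
    qed
  qed
  then obtain m where m: "m \<in> A" and min: "\<And>a. a \<in> A \<Longrightarrow> a \<le> m \<Longrightarrow> a = m" by blast
  have "linear m"
    \<comment> \<open>A sublinear functional below \<open>m\<close> is also below \<open>p\<close>
      and so lies in \<open>A\<close>; minimality in \<open>A\<close> is therefore minimality among
      all sublinear functionals.\<close>
    using m min by (intro minimal_sublinear_linear) (auto simp: A_def intro: order_trans)
  with m show thesis by (intro that) (auto simp: A_def)
qed

section \<open>Norm-bounded extension of real functionals\<close>

lemma Hahn_Banach_real:
  fixes u :: "'a::real_normed_vector \<Rightarrow> real"
  assumes Y: "subspace Y"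
    and add: "\<And>x y. x \<in> Y \<Longrightarrow> y \<in> Y \<Longrightarrow> u (x + y) = u x + u y"
    and scale: "\<And>t x. x \<in> Y \<Longrightarrow> u (t *\<^sub>R x) = t * u x"
    and bound: "\<And>x. x \<in> Y \<Longrightarrow> \<bar>u x\<bar> \<le> C * norm x" and "0 \<le> C"
  obtains g where "linear g" "\<And>x. \<bar>g x\<bar> \<le> C * norm x" "\<And>x. x \<in> Y \<Longrightarrow> g x = u x"
proof -
  \<comment> \<open>\<open>p\<close> is the largest sublinear functional below both \<open>C * norm\<close> and, on \<open>Y\<close>, \<open>u\<close>.\<close>
  define h where "h = (\<lambda>y x. C * norm (x - y) + u y)"
  define p where "p = (\<lambda>x. INF y\<in>Y. h y x)"
  have bdd: "bdd_below ((\<lambda>y. h y x) ` Y)" for x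
  proof (rule bdd_belowI2)
    fix y assume "y \<in> Y"
    have "C * norm y \<le> C * (norm (x - y) + norm x)"
      using norm_triangle_sub [of y x] \<open>0 \<le> C\<close>
      by (intro mult_left_mono) (auto simp: norm_minus_commute algebra_simps)
    then show "- C * norm x \<le> h y x"
      using bound [OF \<open>y \<in> Y\<close>] by (simp add: h_def algebra_simps abs_le_iff)
  qed
  have "sublinear p"
    unfolding p_def
  proof (rule sublinear_INF [OF _ bdd])
    show "Y \<noteq> {}" using subspace_0 [OF Y] by blast
  next
    fix y z v w assume yz: "y \<in> Y" "z \<in> Y"
    have "C * norm ((v - y) + (w - z)) \<le> C * (norm (v - y) + norm (w - z))"
      by (intro mult_left_mono norm_triangle_ineq \<open>0 \<le> C\<close>)
    then have "h (y + z) (v + w) \<le> h y v + h z w"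
      by (simp add: h_def add [OF yz] algebra_simps)
    then show "\<exists>k\<in>Y. h k (v + w) \<le> h y v + h z w"
      using subspace_add [OF Y yz] by blast
  next
    fix y v and t :: real assume y: "y \<in> Y" and t: "0 < t"
    have "norm (t *\<^sub>R v - t *\<^sub>R y) = t * norm (v - y)"
      using t by (simp flip: scaleR_diff_right)
    then have "h (t *\<^sub>R y) (t *\<^sub>R v) \<le> t * h y v"
      by (simp add: h_def scale [OF y] algebra_simps)
    then show "\<exists>k\<in>Y. h k (t *\<^sub>R v) \<le> t * h y v"
      using subspace_scale [OF Y y] by blast
  qed
  then obtain g where g: "linear g" "g \<le> p" by (rule sublinear_dominates_linear)
  \<comment> \<open>Every choice of \<open>y\<close> in \<open>Y\<close> now bounds
    \<open>g\<close>: \<open>y = 0\<close> gives the norm bound, and \<open>y = x\<close> gives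
    \<open>g \<le> u\<close> on \<open>Y\<close>, because \<open>h x x = u x\<close>. Applying the
    latter at \<open>x\<close> and \<open>- x\<close> forces equality.\<close>
  have le: "g x \<le> h y x" if "y \<in> Y" for x y
  proof -
    have "g x \<le> p x" using g(2) by (simp add: le_fun_def)
    also have "p x \<le> h y x" unfolding p_def by (rule cINF_lower [OF bdd that])
    finally show ?thesis .
  qed
  have "g x \<le> C * norm x" for x
    using le [OF subspace_0 [OF Y], of x] scale [OF subspace_0 [OF Y], of 0] by (simp add: h_def)
  note upper = this
  have "\<bar>g x\<bar> \<le> C * norm x" for x
    using upper [of x] upper [of "- x"] by (simp add: abs_le_iff linear_neg [OF g(1)])
  moreover have "g x = u x" if x: "x \<in> Y" for x
  proof -
    have "- x \<in> Y" by (rule subspace_neg [OF Y x])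
    then have "g (- x) \<le> - u x"
      using le [of "- x" "- x"] scale [OF x, of "-1"] by (simp add: h_def)
    moreover have "g x \<le> u x" using le [OF x, of x] by (simp add: h_def)
    ultimately show ?thesis by (simp add: linear_neg [OF g(1)])
  qed
  ultimately show thesis using g(1) that by blast
qed

text \<open>Prepares the passage between scalar functionals and their real parts. In the complex
  case \<open>r\<close> is the real part; as \<open>j * x\<close> has real part minus the imaginary
  part of \<open>x\<close>, the last clause rebuilds \<open>x\<close> from \<open>r\<close>
  alone.\<close>

lemma real_or_complex_cases:
  obtains (real) "\<And>x::'k::real_or_complex. \<exists>a. x = of_real a"
  | (complex) j r where "j * j = (- 1 :: 'k)" "linear r" "\<And>x. \<bar>r x\<bar> \<le> norm x"
      "\<And>x. x = of_real (r x) - of_real (r (j * x)) * j"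
proof (cases "\<forall>x::'k. \<exists>a. x = a *\<^sub>R 1")
  case True
  then show thesis by (intro real) (simp add: of_real_def)
next
  case False
  then obtain j :: 'k where jj: "j * j = - 1"
    and rep: "\<And>x. \<exists>a b. x = a *\<^sub>R 1 + b *\<^sub>R j \<and> norm x = sqrt (a\<^sup>2 + b\<^sup>2)"
    using real_or_complex [where 'a = 'k] by blast
  \<comment> \<open>Squaring \<open>a = - b j\<close> gives \<open>a * a = - (b * b)\<close>, so
    both vanish. Independence makes the coordinates unique, and linearity of \<open>r\<close> then
    follows by exhibiting representations.\<close>
  have indep: "a = 0 \<and> b = 0" if "of_real a + of_real b * j = 0" for a b
  proof -
    have eq: "of_real a = - of_real b * j" using that by (simp add: eq_neg_iff_add_eq_0)
    have "(of_real (a * a) :: 'k) = (- of_real b * j) * (- of_real b * j)"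
      by (simp only: of_real_mult eq)
    also have "\<dots> = of_real b * of_real b * (j * j)" by (simp add: algebra_simps)
    also have "\<dots> = of_real (- (b * b))" by (simp add: jj)
    finally have "a * a = - (b * b)" by (simp only: of_real_eq_iff)
    then have "a * a + b * b = 0" by simp
    then show ?thesis by (simp add: sum_squares_eq_zero_iff)
  qed
  have unique: "a = a' \<and> b = b'"
    if "of_real a + of_real b * j = of_real a' + of_real b' * j" for a b a' b'
    using indep [of "a - a'" "b - b'"] that by (simp add: algebra_simps)
  have "\<forall>x. \<exists>a b. x = of_real a + of_real b * j \<and> norm x = sqrt (a\<^sup>2 + b\<^sup>2)"
    using rep by (simp add: scaleR_conv_of_real)
  then obtain r s where rs: "\<And>x. x = of_real (r x) + of_real (s x) * j"
    and norm: "\<And>x. norm x = sqrt ((r x)\<^sup>2 + (s x)\<^sup>2)"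
    by metis
  have r: "r x = a" "s x = b" if "x = of_real a + of_real b * j" for x a b
    using unique [of "r x" "s x" a b] rs [of x] that by auto
  have "linear r"
  proof (rule linearI)
    fix x y
    have "x + y = of_real (r x + r y) + of_real (s x + s y) * j"
      by (subst (1) rs [of x], subst (1) rs [of y]) (simp add: algebra_simps)
    then show "r (x + y) = r x + r y" by (rule r)
  next
    fix t x
    have "t *\<^sub>R x = of_real (t * r x) + of_real (t * s x) * j"
      by (subst (1) rs [of x]) (simp add: algebra_simps scaleR_conv_of_real)
    then have "r (t *\<^sub>R x) = t * r x" by (rule r)
    then show "r (t *\<^sub>R x) = t *\<^sub>R r x" by simp
  qed
  moreover have "\<bar>r x\<bar> \<le> norm x" for x by (simp add: norm)
  moreover have "x = of_real (r x) - of_real (r (j * x)) * j" for x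
  proof -
    have "j * x = of_real (r x) * j + of_real (s x) * (j * j)"
      by (subst (1) rs [of x]) (simp add: algebra_simps)
    then have "j * x = of_real (- s x) + of_real (r x) * j" by (simp add: jj)
    then have "r (j * x) = - s x" by (rule r)
    then show ?thesis by (subst (1) rs [of x]) simp
  qed
  ultimately show thesis using jj by (intro complex)
qed

section \<open>Hahn--Banach extension over real or complex scalars\<close>

lemma normed_scaling_vector_space: "normed_scaling sc \<Longrightarrow> vector_space sc"
  by (simp add: normed_scaling_def)

lemma normed_scaling_of_real: "normed_scaling sc \<Longrightarrow> sc (of_real r) x = r *\<^sub>R x"
  by (simp add: normed_scaling_def)

lemma normed_scaling_norm: "normed_scaling sc \<Longrightarrow> norm (sc c x) = norm c * norm x"
  by (simp add: normed_scaling_def)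

lemma subspace_normed_scaling:
  assumes sc: "normed_scaling sc" and Y: "module.subspace sc Y"
  shows "subspace Y"
proof -
  interpret S: vector_space sc by (rule normed_scaling_vector_space [OF sc])
  show ?thesis
    using Y S.subspace_scale [OF Y, of _ "of_real _"]
    by (auto simp: subspace_def S.subspace_def normed_scaling_of_real [OF sc])
qed

text \<open>The real theorem is applied to \<open>r\<close> composed with \<open>\<phi>\<close>,
  where \<open>r\<close> identifies the scalars with the reals or takes real parts; the scalar
  functional is then rebuilt. The bound \<open>D\<close> may exceed \<open>C\<close>, as only
  boundedness is claimed.\<close>

theorem Hahn_Banach:
  fixes sc :: "'k::real_or_complex \<Rightarrow> 'a::real_normed_vector \<Rightarrow> 'a"
  assumes sc: "normed_scaling sc" and Y: "module.subspace sc Y"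
    and lin: "linear_map_on sc (*) Y \<phi>" and bound: "\<And>y. y \<in> Y \<Longrightarrow> norm (\<phi> y) \<le> C * norm y"
  obtains g D where "linear_map_on sc (*) UNIV g" "\<And>x. norm (g x) \<le> D * norm x"
    "\<And>y. y \<in> Y \<Longrightarrow> g y = \<phi> y"
proof -
  interpret S: vector_space sc by (rule normed_scaling_vector_space [OF sc])
  have add: "\<phi> (x + y) = \<phi> x + \<phi> y" if "x \<in> Y" "y \<in> Y" for x y
    using lin that by (simp add: linear_map_on_def)
  have scale: "\<phi> (sc c x) = c * \<phi> x" if "x \<in> Y" for c x
    using lin that by (simp add: linear_map_on_def)
  have Y': "subspace Y" by (rule subspace_normed_scaling [OF sc Y])
  \<comment> \<open>\<open>C\<close> can be negative when \<open>Y\<close> is trivial, while the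
    real extension theorem asks for a nonnegative constant.\<close>
  have "norm (\<phi> x) \<le> \<bar>C\<bar> * norm x" if "x \<in> Y" for x
    using bound [OF that] abs_ge_self [of C] by (meson mult_right_mono norm_ge_zero order_trans)
  note bound = this
  have extend: "\<exists>g. linear g \<and> (\<forall>x. \<bar>g x\<bar> \<le> \<bar>C\<bar> * norm x) \<and> (\<forall>x\<in>Y. g x = r (\<phi> x))"
    if "linear r" "\<And>x. \<bar>r x\<bar> \<le> norm x" for r :: "'k \<Rightarrow> real"
  proof (rule Hahn_Banach_real [OF Y', of "\<lambda>x. r (\<phi> x)" "\<bar>C\<bar>"])
    show "r (\<phi> (t *\<^sub>R x)) = t * r (\<phi> x)" if "x \<in> Y" for t x
      using scale [OF that, of "of_real t"] linear_scale [OF \<open>linear r\<close>, of t "\<phi> x"]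
      by (simp add: normed_scaling_of_real [OF sc] scaleR_conv_of_real)
    show "\<bar>r (\<phi> x)\<bar> \<le> \<bar>C\<bar> * norm x" if "x \<in> Y" for x
      using \<open>\<And>x. \<bar>r x\<bar> \<le> norm x\<close> bound [OF that] by (rule order_trans)
  qed (use that in \<open>auto simp: add linear_add\<close>)
  show thesis
  proof (cases rule: real_or_complex_cases [where 'k = 'k])
    case real
    then obtain r where r: "\<And>x::'k. x = of_real (r x)" by metis
    have rr: "r (of_real a) = a" for a using r [of "of_real a"] by (simp only: of_real_eq_iff)
    have "linear r"
    proof (rule linearI)
      fix x y :: 'k and t :: real
      have "x + y = of_real (r x + r y)" by (simp flip: r)
      then show "r (x + y) = r x + r y" by (metis rr)
      have "t *\<^sub>R x = of_real (t * r x)" by (simp add: scaleR_conv_of_real flip: r)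
      then show "r (t *\<^sub>R x) = t *\<^sub>R r x" by (metis rr real_scaleR_def)
    qed
    moreover have "\<bar>r x\<bar> \<le> norm x" for x
      by (metis r norm_of_real order_refl)
    ultimately obtain g where g: "linear g" "\<And>x. \<bar>g x\<bar> \<le> \<bar>C\<bar> * norm x" "\<And>x. x \<in> Y \<Longrightarrow> g x = r (\<phi> x)"
      using extend by blast
    \<comment> \<open>Each scalar is \<open>of_real (r c)\<close>, so real homogeneity is already
      homogeneity over \<open>'k\<close>.\<close>
    have "of_real (g (sc c x)) = c * of_real (g x)" for c x
      using r [of c] normed_scaling_of_real [OF sc, of "r c" x] linear_scale [OF g(1), of "r c" x]
      by (metis of_real_mult real_scaleR_def)
    then show thesis
      by (intro that [of "\<lambda>x. of_real (g x)" "\<bar>C\<bar>"])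
        (auto simp: linear_map_on_def linear_add [OF g(1)] g simp flip: r)
  next
    case (complex j r)
    then obtain g where g: "linear g" "\<And>x. \<bar>g x\<bar> \<le> \<bar>C\<bar> * norm x" "\<And>x. x \<in> Y \<Longrightarrow> g x = r (\<phi> x)"
      using extend by blast
    \<comment> \<open>A linear functional is recovered from its real part as \<open>Re (\<phi> x) - Re (\<phi> (j x)) j\<close>.\<close>
    define G where "G = (\<lambda>x. of_real (g x) - of_real (g (sc j x)) * j)"
    have G_add: "G (x + y) = G x + G y" for x y
      by (simp add: G_def S.scale_right_distrib linear_add [OF g(1)] algebra_simps)
    have G_real: "G (sc (of_real a) x) = of_real a * G x" for a x
    proof -
      have "sc j (sc (of_real a) x) = sc (of_real a) (sc j x)" by (simp add: mult.commute del: of_real_mult)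
      then have "sc j (a *\<^sub>R x) = a *\<^sub>R sc j x" by (simp only: normed_scaling_of_real [OF sc])
      then show ?thesis
        by (simp add: G_def normed_scaling_of_real [OF sc] linear_scale [OF g(1)] algebra_simps)
    qed
    \<comment> \<open>Applying \<open>sc j\<close> exchanges the two terms of \<open>G\<close> up to
      the sign from \<open>j * j = - 1\<close>. Homogeneity under \<open>j\<close> and under real
      scalars covers every \<open>c\<close>, which is a real combination of \<open>1\<close> and
      \<open>j\<close>.\<close>
    have "sc j (sc j x) = - x" for x by (simp add: complex(1))
    then have G_j: "G (sc j x) = j * G x" for x
      by (simp add: G_def linear_neg [OF g(1)] algebra_simps complex(1) flip: mult.assoc)
    have "linear_map_on sc (*) UNIV G"
      unfolding linear_map_on_def
    proof (intro conjI ballI allI)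
      fix c x
      have c: "c = of_real (r c) + of_real (- r (j * c)) * j" using complex(4) [of c] by simp
      have "G (sc c x) = G (sc (of_real (r c)) x + sc (of_real (- r (j * c))) (sc j x))"
        by (subst (1) c) (simp only: S.scale_left_distrib S.scale_scale)
      also have "\<dots> = (of_real (r c) + of_real (- r (j * c)) * j) * G x"
        by (simp only: G_add G_real G_j) (simp add: algebra_simps)
      finally show "G (sc c x) = c * G x" using c by simp
    qed (rule G_add)
    moreover have "norm (G x) \<le> (\<bar>C\<bar> + \<bar>C\<bar> * norm j * norm j) * norm x" for x
    proof -
      have "norm (G x) \<le> \<bar>g x\<bar> + \<bar>g (sc j x)\<bar> * norm j"
        unfolding G_def by (rule order_trans [OF norm_triangle_ineq4]) (simp add: norm_mult)
      also have "\<dots> \<le> \<bar>C\<bar> * norm x + (\<bar>C\<bar> * norm (sc j x)) * norm j"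
        by (intro add_mono mult_right_mono g) auto
      finally show ?thesis by (simp add: normed_scaling_norm [OF sc] algebra_simps)
    qed
    \<comment> \<open>On \<open>Y\<close>, \<open>g\<close> is the real part of
      \<open>\<phi>\<close>, and \<open>\<phi> (sc j y) = j * \<phi> y\<close>, so
      \<open>G y\<close> is exactly the reconstruction of \<open>\<phi> y\<close> from real
      parts.\<close>
    moreover have "G y = \<phi> y" if y: "y \<in> Y" for y
      using complex(4) [of "\<phi> y"] S.subspace_scale [OF Y y, of j]
      by (simp add: G_def g(3) scale y)
    ultimately show thesis by (rule that)
  qed
qed

section \<open>The dual of a subspace\<close>

lemma dual_onD:
  assumes "\<phi> \<in> dual_on sc Y"
  shows "\<And>x y. x \<in> Y \<Longrightarrow> y \<in> Y \<Longrightarrow> \<phi> (x + y) = \<phi> x + \<phi> y"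
    and "\<And>c x. x \<in> Y \<Longrightarrow> \<phi> (sc c x) = c * \<phi> x"
    and "\<And>y. y \<notin> Y \<Longrightarrow> \<phi> y = 0"
    and "\<exists>C. \<forall>y\<in>Y. norm (\<phi> y) \<le> C * norm y"
  using assms by (auto simp: dual_on_def linear_map_on_def)

lemma dual_onI:
  assumes "\<And>x y. x \<in> Y \<Longrightarrow> y \<in> Y \<Longrightarrow> \<phi> (x + y) = \<phi> x + \<phi> y"
    and "\<And>c x. x \<in> Y \<Longrightarrow> \<phi> (sc c x) = c * \<phi> x"
    and "\<And>y. y \<notin> Y \<Longrightarrow> \<phi> y = 0"
    and "\<And>y. y \<in> Y \<Longrightarrow> norm (\<phi> y) \<le> C * norm y"
  shows "\<phi> \<in> dual_on sc Y"
  unfolding dual_on_def linear_map_on_def using assms by blast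

locale normed_subspace =
  fixes sc :: "'k::real_normed_field \<Rightarrow> 'b::real_normed_vector \<Rightarrow> 'b" and Y :: "'b set"
  assumes sc: "normed_scaling sc" and Y: "module.subspace sc Y"
begin

sublocale S: vector_space sc by (rule normed_scaling_vector_space [OF sc])

lemma dual_on_add:
  assumes "\<phi> \<in> dual_on sc Y" "\<psi> \<in> dual_on sc Y"
  shows "\<phi> + \<psi> \<in> dual_on sc Y"
proof -
  obtain C D where "\<forall>y\<in>Y. norm (\<phi> y) \<le> C * norm y" "\<forall>y\<in>Y. norm (\<psi> y) \<le> D * norm y"
    using dual_onD(4) assms by metis
  then have "norm (\<phi> y + \<psi> y) \<le> (C + D) * norm y" if "y \<in> Y" for y
    using that norm_triangle_ineq [of "\<phi> y" "\<psi> y"] by (fastforce simp: algebra_simps)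
  with dual_onD(1-3) [OF assms(1)] dual_onD(1-3) [OF assms(2)] show ?thesis
    by (intro dual_onI [where C = "C + D"]) (auto simp: algebra_simps)
qed

text \<open>\<open>seq_scale\<close> is pointwise multiplication over any index type, so it also
  serves as the scalar multiplication of functionals.\<close>

lemma dual_on_scale:
  assumes "\<phi> \<in> dual_on sc Y"
  shows "seq_scale c \<phi> \<in> dual_on sc Y"
proof -
  obtain C where "\<forall>y\<in>Y. norm (\<phi> y) \<le> C * norm y"
    using dual_onD(4) assms by metis
  then have "norm (c * \<phi> y) \<le> (norm c * C) * norm y" if "y \<in> Y" for y
    using that by (simp add: norm_mult mult.assoc mult_left_mono)
  with dual_onD(1-3) [OF assms] show ?thesis
    by (intro dual_onI [where C = "norm c * C"]) (auto simp: seq_scale_def algebra_simps)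
qed

lemma dual_on_0: "0 \<in> dual_on sc Y"
  by (rule dual_onI [where C = 0]) auto

lemma dual_on_diff:
  assumes "\<phi> \<in> dual_on sc Y" "\<psi> \<in> dual_on sc Y"
  shows "\<phi> - \<psi> \<in> dual_on sc Y"
proof -
  have "\<phi> - \<psi> = \<phi> + seq_scale (- 1) \<psi>" by (auto simp: seq_scale_def fun_eq_iff)
  then show ?thesis using dual_on_add dual_on_scale assms by metis
qed

lemma dual_norm_on_le:
  assumes "0 \<le> C" "\<And>y. y \<in> Y \<Longrightarrow> norm (\<phi> y) \<le> C * norm y"
  shows "dual_norm_on Y \<phi> \<le> C"
  unfolding dual_norm_on_def
proof (rule cSUP_least)
  show "{y \<in> Y. norm y \<le> 1} \<noteq> {}" using S.subspace_0 [OF Y] by auto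
  fix y assume "y \<in> {y \<in> Y. norm y \<le> 1}"
  then show "norm (\<phi> y) \<le> C"
    using assms(2) [of y] mult_left_mono [of "norm y" 1 C] \<open>0 \<le> C\<close> by simp
qed

lemma norm_le_dual_norm_on_unit:
  assumes "\<phi> \<in> dual_on sc Y" "y \<in> Y" "norm y \<le> 1"
  shows "norm (\<phi> y) \<le> dual_norm_on Y \<phi>"
  unfolding dual_norm_on_def
proof (rule cSUP_upper)
  obtain C where C: "\<forall>y\<in>Y. norm (\<phi> y) \<le> C * norm y" using dual_onD(4) assms(1) by metis
  \<comment> \<open>The real supremum is an upper bound only of a bounded set; boundedness of
    \<open>\<phi>\<close> supplies this.\<close>
  show "bdd_above ((\<lambda>y. norm (\<phi> y)) ` {y \<in> Y. norm y \<le> 1})"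
  proof (rule bdd_aboveI2)
    fix y assume "y \<in> {y \<in> Y. norm y \<le> 1}"
    then have "norm (\<phi> y) \<le> C * norm y" "norm y \<le> 1" using C by auto
    then show "norm (\<phi> y) \<le> \<bar>C\<bar>"
      by (smt (verit) mult_left_le mult_right_mono norm_ge_zero)
  qed
qed (use assms in auto)

lemma dual_on_apply_0:
  assumes "\<phi> \<in> dual_on sc Y"
  shows "\<phi> 0 = 0"
  using dual_onD(2) [OF assms S.subspace_0 [OF Y], of 0] by simp

lemma dual_norm_on_nonneg:
  assumes "\<phi> \<in> dual_on sc Y"
  shows "0 \<le> dual_norm_on Y \<phi>"
  using norm_le_dual_norm_on_unit [OF assms S.subspace_0 [OF Y]] dual_on_apply_0 [OF assms] by simp

text \<open>Normalising \<open>y\<close> reduces the claim to the unit ball. Outside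
  \<open>Y\<close> the functional is 0 by its encoding, so the estimate holds for every vector of
  the type.\<close>

lemma norm_le_dual_norm_on:
  assumes "\<phi> \<in> dual_on sc Y"
  shows "norm (\<phi> y) \<le> dual_norm_on Y \<phi> * norm y"
proof (cases "y \<in> Y \<and> y \<noteq> 0")
  case False
  then show ?thesis
    using dual_onD(3) [OF assms] dual_on_apply_0 [OF assms] dual_norm_on_nonneg [OF assms] by auto
next
  case True
  define c :: 'k where "c = of_real (inverse (norm y))"
  have c: "norm c = inverse (norm y)" by (simp add: c_def norm_inverse)
  have "norm (\<phi> (sc c y)) \<le> dual_norm_on Y \<phi>"
    using True S.subspace_scale [OF Y, of y c]
    by (intro norm_le_dual_norm_on_unit assms) (auto simp: normed_scaling_norm [OF sc] c)
  then have "inverse (norm y) * norm (\<phi> y) \<le> dual_norm_on Y \<phi>"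
    using True dual_onD(2) [OF assms, of y c] by (simp add: norm_mult c)
  then show ?thesis using True by (simp add: field_simps)
qed

lemma dual_norm_on_eq_0_iff:
  assumes "\<phi> \<in> dual_on sc Y"
  shows "dual_norm_on Y \<phi> = 0 \<longleftrightarrow> \<phi> = 0"
proof
  assume "dual_norm_on Y \<phi> = 0"
  then show "\<phi> = 0" using norm_le_dual_norm_on [OF assms] by (auto simp: fun_eq_iff)
next
  assume "\<phi> = 0"
  then show "dual_norm_on Y \<phi> = 0"
    using dual_norm_on_le [of 0 \<phi>] dual_norm_on_nonneg [OF assms] by simp
qed

lemma dual_norm_on_triangle:
  assumes "\<phi> \<in> dual_on sc Y" "\<psi> \<in> dual_on sc Y"
  shows "dual_norm_on Y (\<phi> + \<psi>) \<le> dual_norm_on Y \<phi> + dual_norm_on Y \<psi>"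
proof (rule dual_norm_on_le)
  fix y
  have "norm ((\<phi> + \<psi>) y) \<le> norm (\<phi> y) + norm (\<psi> y)" by (simp add: norm_triangle_ineq)
  then show "norm ((\<phi> + \<psi>) y) \<le> (dual_norm_on Y \<phi> + dual_norm_on Y \<psi>) * norm y"
    using norm_le_dual_norm_on [OF assms(1), of y] norm_le_dual_norm_on [OF assms(2), of y]
    by (simp add: algebra_simps)
qed (simp add: dual_norm_on_nonneg assms)

lemma dual_norm_on_scale_le:
  assumes "\<phi> \<in> dual_on sc Y"
  shows "dual_norm_on Y (seq_scale c \<phi>) \<le> norm c * dual_norm_on Y \<phi>"
  using norm_le_dual_norm_on [OF assms]
  by (intro dual_norm_on_le)
    (auto simp: seq_scale_def norm_mult dual_norm_on_nonneg assms mult.assoc mult_left_mono)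

text \<open>For nonzero \<open>c\<close> the reverse inequality is the easy one applied to
  \<open>inverse c\<close>.\<close>

lemma dual_norm_on_scale:
  assumes "\<phi> \<in> dual_on sc Y"
  shows "dual_norm_on Y (seq_scale c \<phi>) = norm c * dual_norm_on Y \<phi>"
proof (cases "c = 0")
  case True
  then show ?thesis
    using dual_norm_on_scale_le [OF assms, of c] dual_norm_on_nonneg [OF dual_on_scale [OF assms], of c]
    by simp
next
  case False
  then have "seq_scale (inverse c) (seq_scale c \<phi>) = \<phi>"
    by (simp add: seq_scale_def fun_eq_iff mult.assoc [symmetric])
  then have "dual_norm_on Y \<phi> \<le> norm (inverse c) * dual_norm_on Y (seq_scale c \<phi>)"
    using dual_norm_on_scale_le [OF dual_on_scale [OF assms, of c], of "inverse c"] by simp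
  then have "norm c * dual_norm_on Y \<phi> \<le> dual_norm_on Y (seq_scale c \<phi>)"
    using False by (simp add: norm_divide field_simps)
  then show ?thesis using dual_norm_on_scale_le [OF assms, of c] by simp
qed

end

text \<open>Completeness of the scalars gives a pointwise limit; the Cauchy estimate survives the
  limit and shows that it is bounded and is attained in norm. This later provides completeness of
  the sequence space.\<close>

lemma dual_on_complete:
  fixes sc :: "'k::{real_normed_field,banach} \<Rightarrow> 'b::real_normed_vector \<Rightarrow> 'b"
  assumes "normed_subspace sc Y"
    and s: "\<And>n. s n \<in> dual_on sc Y"
    and cauchy: "\<And>e. 0 < e \<Longrightarrow> \<exists>M. \<forall>m\<ge>M. \<forall>n\<ge>M. dual_norm_on Y (s m - s n) < e"
  obtains \<phi> where "\<phi> \<in> dual_on sc Y" "(\<lambda>n. dual_norm_on Y (s n - \<phi>)) \<longlonglongrightarrow> 0"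
proof -
  interpret normed_subspace sc Y by fact
  have diff: "s m - s n \<in> dual_on sc Y" for m n by (rule dual_on_diff [OF s s])
  have "Cauchy (\<lambda>n. s n y)" for y
  proof (rule CauchyI)
    fix e :: real assume "0 < e"
    \<comment> \<open>The summand 1 keeps the denominator positive when
      \<open>y = 0\<close>.\<close>
    then obtain M where M: "\<forall>m\<ge>M. \<forall>n\<ge>M. dual_norm_on Y (s m - s n) < e / (norm y + 1)"
      using cauchy [of "e / (norm y + 1)"] by (auto simp: add_nonneg_pos)
    have "norm (s m y - s n y) < e" if "m \<ge> M" "n \<ge> M" for m n
    proof -
      have "norm (s m y - s n y) \<le> dual_norm_on Y (s m - s n) * norm y"
        using norm_le_dual_norm_on [OF diff, of m n y] by simp
      also have "\<dots> \<le> dual_norm_on Y (s m - s n) * (norm y + 1)"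
        using dual_norm_on_nonneg [OF diff, of m n] by (intro mult_left_mono) auto
      also have "\<dots> < e / (norm y + 1) * (norm y + 1)"
        using M that by (intro mult_strict_right_mono) (auto simp: add_nonneg_pos)
      also have "\<dots> = e" using norm_ge_zero [of y] by (simp add: add_nonneg_eq_0_iff)
      finally show ?thesis .
    qed
    then show "\<exists>M. \<forall>m\<ge>M. \<forall>n\<ge>M. norm (s m y - s n y) < e" by blast
  qed
  then have "\<exists>l. (\<lambda>n. s n y) \<longlonglongrightarrow> l" for y by (simp add: Cauchy_convergent_iff convergent_def)
  then obtain \<phi> where lim: "\<And>y. (\<lambda>n. s n y) \<longlonglongrightarrow> \<phi> y" by metis
  \<comment> \<open>Letting \<open>m\<close> tend to infinity in the Cauchy estimate gives a bound
    uniform on the unit ball. With \<open>e = 1\<close> it bounds \<open>\<phi>\<close>; with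
    \<open>e / 2\<close>, which makes up for the nonstrict inequality, it gives norm
    convergence.\<close>
  have close: "norm (s n y - \<phi> y) \<le> e * norm y"
    if M: "\<forall>m\<ge>M. \<forall>n\<ge>M. dual_norm_on Y (s m - s n) < e" and n: "n \<ge> M" for n M e y
  proof (rule LIMSEQ_le_const2)
    show "(\<lambda>m. norm (s n y - s m y)) \<longlonglongrightarrow> norm (s n y - \<phi> y)"
      by (intro tendsto_intros lim)
    have "norm (s n y - s m y) \<le> e * norm y" if "m \<ge> M" for m
    proof -
      have "norm (s n y - s m y) \<le> dual_norm_on Y (s n - s m) * norm y"
        using norm_le_dual_norm_on [OF diff, of n m y] by simp
      also have "\<dots> \<le> e * norm y"
        using M n that by (intro mult_right_mono) (auto intro: less_imp_le)
      finally show ?thesis .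
    qed
    then show "\<exists>N. \<forall>m\<ge>N. norm (s n y - s m y) \<le> e * norm y" by blast
  qed
  have \<phi>: "\<phi> \<in> dual_on sc Y"
  proof -
    obtain M where M: "\<forall>m\<ge>M. \<forall>n\<ge>M. dual_norm_on Y (s m - s n) < 1"
      using cauchy [of 1] by auto
    show ?thesis
    proof (rule dual_onI)
      fix x y assume "x \<in> Y" "y \<in> Y"
      then have "(\<lambda>n. s n (x + y)) = (\<lambda>n. s n x + s n y)" using dual_onD(1) [OF s] by auto
      then show "\<phi> (x + y) = \<phi> x + \<phi> y"
        using LIMSEQ_unique [OF lim [of "x + y"]] tendsto_add [OF lim lim] by metis
    next
      fix c x assume "x \<in> Y"
      then have "(\<lambda>n. s n (sc c x)) = (\<lambda>n. c * s n x)" using dual_onD(2) [OF s] by auto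
      then show "\<phi> (sc c x) = c * \<phi> x"
        using LIMSEQ_unique [OF lim [of "sc c x"]] tendsto_mult_left [OF lim] by metis
    next
      fix y assume "y \<notin> Y"
      then have "(\<lambda>n. s n y) = (\<lambda>n. 0)" using dual_onD(3) [OF s] by auto
      then show "\<phi> y = 0"
        using LIMSEQ_unique [OF lim [of y]] tendsto_const by metis
    next
      fix y
      have "norm (\<phi> y) \<le> norm (s M y) + norm (s M y - \<phi> y)"
        using norm_triangle_sub [of "\<phi> y" "s M y"] by (simp add: norm_minus_commute)
      then show "norm (\<phi> y) \<le> (dual_norm_on Y (s M) + 1) * norm y"
        using close [OF M order_refl, of y] norm_le_dual_norm_on [OF s, of M y]
        by (simp add: algebra_simps)
    qed
  qed
  have "(\<lambda>n. dual_norm_on Y (s n - \<phi>)) \<longlonglongrightarrow> 0"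
  proof (rule LIMSEQ_I)
    fix e :: real assume e: "0 < e"
    then obtain M where M: "\<forall>m\<ge>M. \<forall>n\<ge>M. dual_norm_on Y (s m - s n) < e / 2"
      using cauchy [of "e / 2"] by auto
    have "norm (dual_norm_on Y (s n - \<phi>) - 0) < e" if "n \<ge> M" for n
    proof -
      have "dual_norm_on Y (s n - \<phi>) \<le> e / 2"
        using close [OF M that] e by (intro dual_norm_on_le) auto
      then show ?thesis using e dual_norm_on_nonneg [OF dual_on_diff [OF s \<phi>], of n] by simp
    qed
    then show "\<exists>M. \<forall>n\<ge>M. norm (dual_norm_on Y (s n - \<phi>) - 0) < e" by blast
  qed
  with \<phi> show thesis by (rule that)
qed

section \<open>Closed spans and functionals on them\<close>

lemma closed_span_subspace:
  fixes sc :: "'k::real_normed_field \<Rightarrow> 'b::real_normed_vector \<Rightarrow> 'b"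
  assumes sc: "normed_scaling sc"
  shows "module.subspace sc (closed_span sc y)"
proof -
  interpret S: vector_space sc by (rule normed_scaling_vector_space [OF sc])
  show ?thesis
    unfolding S.subspace_def closed_span_def
  proof (intro conjI ballI allI)
    show "0 \<in> closure (S.span (range y))"
      using S.span_zero closure_subset by blast
  next
    fix u v assume "u \<in> closure (S.span (range y))" "v \<in> closure (S.span (range y))"
    then obtain s t where "\<And>n. s n \<in> S.span (range y)" "s \<longlonglongrightarrow> u"
      "\<And>n. t n \<in> S.span (range y)" "t \<longlonglongrightarrow> v"
      unfolding closure_sequential by blast
    then show "u + v \<in> closure (S.span (range y))"
      unfolding closure_sequential
      by (intro exI [of _ "\<lambda>n. s n + t n"]) (auto intro: S.span_add tendsto_add)
  next
    fix c :: 'k and u assume "u \<in> closure (S.span (range y))"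
    then obtain s where s: "\<And>n. s n \<in> S.span (range y)" "s \<longlonglongrightarrow> u"
      unfolding closure_sequential by blast
    \<comment> \<open>Continuity of \<open>sc c\<close> is drawn from the identity
      \<open>norm (sc c x) = norm c * norm x\<close>.\<close>
    have "(\<lambda>n. norm c * norm (s n - u)) \<longlonglongrightarrow> norm c * 0"
      using s(2) by (intro tendsto_mult_left) (simp add: tendsto_norm_zero LIM_zero)
    then have "(\<lambda>n. norm (sc c (s n) - sc c u)) \<longlonglongrightarrow> 0"
      by (simp add: normed_scaling_norm [OF sc] flip: S.scale_right_diff_distrib)
    then have "(\<lambda>n. sc c (s n)) \<longlonglongrightarrow> sc c u"
      by (rule LIM_zero_cancel [OF tendsto_norm_zero_cancel])
    with s(1) show "sc c u \<in> closure (S.span (range y))"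
      unfolding closure_sequential by (auto intro!: exI [of _ "\<lambda>n. sc c (s n)"] S.span_scale)
  qed
qed

lemma closed_span_base:
  assumes "normed_scaling sc"
  shows "y k \<in> closed_span sc y"
proof -
  interpret S: vector_space sc by (rule normed_scaling_vector_space [OF assms])
  have "y k \<in> S.span (range y)" by (rule S.span_base) simp
  then show ?thesis unfolding closed_span_def using closure_subset by blast
qed

text \<open>The kernel of \<open>\<phi>\<close> is a subspace containing the generators, hence their
  span, and boundedness carries the vanishing over to the closure.\<close>

lemma dual_on_closed_span_eq_0:
  assumes sc: "normed_scaling sc" and \<phi>: "\<phi> \<in> dual_on sc (closed_span sc y)"
    and zero: "\<And>k. \<phi> (y k) = 0"
  shows "\<phi> = 0"
proof -
  let ?Y = "closed_span sc y"
  interpret normed_subspace sc ?Y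
    by (intro normed_subspace.intro sc closed_span_subspace)
  have "S.subspace {v \<in> ?Y. \<phi> v = 0}"
    using Y dual_onD(1,2) [OF \<phi>] dual_on_apply_0 [OF \<phi>] by (auto simp: S.subspace_def)
  then have span: "S.span (range y) \<subseteq> {v \<in> ?Y. \<phi> v = 0}"
    by (intro S.span_minimal) (auto simp: zero closed_span_base [OF sc])
  have "\<phi> v = 0" if v: "v \<in> ?Y" for v
  proof -
    obtain s where s: "\<And>n. s n \<in> S.span (range y)" "s \<longlonglongrightarrow> v"
      using v unfolding closed_span_def closure_sequential by blast
    have "norm (\<phi> v) \<le> dual_norm_on ?Y \<phi> * norm (v - s n)" for n
    proof -
      have sn: "s n \<in> ?Y" "\<phi> (s n) = 0" using span s(1) by auto
      \<comment> \<open>Additivity of \<open>\<phi>\<close> is available only inside the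
        subspace.\<close>
      have "v - s n \<in> ?Y" by (rule S.subspace_diff [OF Y v sn(1)])
      then have "\<phi> v = \<phi> (v - s n)" using dual_onD(1) [OF \<phi> _ sn(1), of "v - s n"] sn by simp
      then show ?thesis using norm_le_dual_norm_on [OF \<phi>, of "v - s n"] by simp
    qed
    moreover have "(\<lambda>n. dual_norm_on ?Y \<phi> * norm (v - s n)) \<longlonglongrightarrow> dual_norm_on ?Y \<phi> * norm (v - v)"
      by (intro tendsto_intros s(2))
    ultimately have "norm (\<phi> v) \<le> dual_norm_on ?Y \<phi> * norm (v - v)"
      by (intro LIMSEQ_le_const) auto
    then show ?thesis by simp
  qed
  then show ?thesis using dual_onD(3) [OF \<phi>] by (auto simp: fun_eq_iff)
qed

section \<open>Retro Banach frames\<close>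

text \<open>As \<open>Z\<close> and \<open>N\<close> may be chosen freely, injectivity is the only
  obstruction: the coefficient map can be declared an isometry onto its range.\<close>

lemma retro_banach_frame_iff_injective:
  fixes sc :: "'k::{real_normed_field,banach} \<Rightarrow> 'b::real_normed_vector \<Rightarrow> 'b"
  assumes sub: "normed_subspace sc Y" and y: "\<And>k. y k \<in> Y"
  shows "(\<exists>Z N \<Theta>. retro_banach_frame sc Y y Z N \<Theta>) \<longleftrightarrow>
    (\<forall>\<phi>\<in>dual_on sc Y. (\<forall>k. \<phi> (y k) = 0) \<longrightarrow> \<phi> = 0)"
proof
  assume "\<exists>Z N \<Theta>. retro_banach_frame sc Y y Z N \<Theta>"
  then obtain \<Theta> where \<Theta>: "\<And>\<phi>. \<phi> \<in> dual_on sc Y \<Longrightarrow> \<Theta> (\<lambda>k. \<phi> (y k)) = \<phi>"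
    unfolding retro_banach_frame_def by blast
  show "\<forall>\<phi>\<in>dual_on sc Y. (\<forall>k. \<phi> (y k) = 0) \<longrightarrow> \<phi> = 0"
  proof (intro ballI impI)
    fix \<phi> assume "\<phi> \<in> dual_on sc Y" "\<forall>k. \<phi> (y k) = 0"
    \<comment> \<open>\<open>\<phi>\<close> and the zero functional have the same coefficient
      sequence, and \<open>\<Theta>\<close> recovers both from it.\<close>
    then have "\<phi> = \<Theta> (\<lambda>k. 0)" using \<Theta> [of \<phi>] by simp
    also have "\<dots> = 0"
      using \<Theta> [OF normed_subspace.dual_on_0 [OF sub]] by (simp add: zero_fun_def)
    finally show "\<phi> = 0" .
  qed
next
  interpret normed_subspace sc Y by (rule sub)
  interpret Q: vector_space "seq_scale :: 'k \<Rightarrow> (nat \<Rightarrow> 'k) \<Rightarrow> (nat \<Rightarrow> 'k)"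
    by (rule vector_space_seq_scale)
  assume inj0: "\<forall>\<phi>\<in>dual_on sc Y. (\<forall>k. \<phi> (y k) = 0) \<longrightarrow> \<phi> = 0"
  let ?D = "dual_on sc Y"
  define T :: "('b \<Rightarrow> 'k) \<Rightarrow> (nat \<Rightarrow> 'k)" where "T = (\<lambda>\<phi> k. \<phi> (y k))"
  have T_add: "T (\<phi> + \<psi>) = T \<phi> + T \<psi>" and T_diff: "T (\<phi> - \<psi>) = T \<phi> - T \<psi>"
    and T_scale: "T (seq_scale c \<phi>) = seq_scale c (T \<phi>)" and T_0: "T 0 = 0" for \<phi> \<psi> c
    by (auto simp: T_def seq_scale_def fun_eq_iff)
  have "inj_on T ?D"
  proof (rule inj_onI)
    fix \<phi> \<psi> assume "\<phi> \<in> ?D" "\<psi> \<in> ?D" "T \<phi> = T \<psi>"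
    then have "\<phi> - \<psi> = 0"
      using inj0 dual_on_diff [of \<phi> \<psi>] by (auto simp: T_def fun_eq_iff)
    then show "\<phi> = \<psi>" by simp
  qed
  define \<Theta> where "\<Theta> = inv_into ?D T"
  have \<Theta>T: "\<Theta> (T \<phi>) = \<phi>" if "\<phi> \<in> ?D" for \<phi>
    unfolding \<Theta>_def by (rule inv_into_f_f [OF \<open>inj_on T ?D\<close> that])
  define N where "N = (\<lambda>u. dual_norm_on Y (\<Theta> u))"
  have NT: "N (T \<phi>) = dual_norm_on Y \<phi>" if "\<phi> \<in> ?D" for \<phi>
    using that by (simp add: N_def \<Theta>T)
  have "banach_sequence_space (T ` ?D) N"
    unfolding banach_sequence_space_def
  proof (intro conjI)
    show "Q.subspace (T ` ?D)"
      unfolding Q.subspace_def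
      using dual_on_0 T_0 dual_on_add dual_on_scale
      by (auto simp flip: T_add T_scale intro: rev_image_eqI [where x = 0])
    show "\<forall>u\<in>T ` ?D. 0 \<le> N u \<and> (N u = 0 \<longleftrightarrow> u = 0)"
      using \<open>inj_on T ?D\<close> T_0 dual_on_0
      by (auto simp: NT dual_norm_on_nonneg dual_norm_on_eq_0_iff inj_on_def)
    show "\<forall>c. \<forall>u\<in>T ` ?D. N (seq_scale c u) = norm c * N u"
      by (auto simp: NT dual_on_scale dual_norm_on_scale simp flip: T_scale)
    show "\<forall>u\<in>T ` ?D. \<forall>v\<in>T ` ?D. N (u + v) \<le> N u + N v"
      by (auto simp: NT dual_on_add dual_norm_on_triangle simp flip: T_add)
    show "\<forall>s. range s \<subseteq> T ` ?D \<and> (\<forall>e>0. \<exists>M. \<forall>m\<ge>M. \<forall>n\<ge>M. N (s m - s n) < e) \<longrightarrow>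
        (\<exists>u\<in>T ` ?D. (\<lambda>n. N (s n - u)) \<longlonglongrightarrow> 0)"
    proof (intro allI impI, elim conjE)
      fix s :: "nat \<Rightarrow> nat \<Rightarrow> 'k"
      assume range: "range s \<subseteq> T ` ?D"
        and cauchy: "\<forall>e>0. \<exists>M. \<forall>m\<ge>M. \<forall>n\<ge>M. N (s m - s n) < e"
      from range have "\<forall>n. \<exists>\<phi>. \<phi> \<in> ?D \<and> s n = T \<phi>" by blast
      then obtain \<sigma> where \<sigma>: "\<And>n. \<sigma> n \<in> ?D" and s: "s = (\<lambda>n. T (\<sigma> n))" by metis
      have N: "N (s n - T \<phi>) = dual_norm_on Y (\<sigma> n - \<phi>)" if "\<phi> \<in> ?D" for n \<phi>
        by (simp add: s NT dual_on_diff \<sigma> that flip: T_diff)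
      \<comment> \<open>Pulled back along \<open>T\<close>, a Cauchy sequence for \<open>N\<close>
        is one for the dual norm, where limits exist.\<close>
      have "\<exists>M. \<forall>m\<ge>M. \<forall>n\<ge>M. dual_norm_on Y (\<sigma> m - \<sigma> n) < e" if "0 < e" for e
        using cauchy that N [OF \<sigma>] by (simp add: s)
      then obtain \<phi> where \<phi>: "\<phi> \<in> ?D" "(\<lambda>n. dual_norm_on Y (\<sigma> n - \<phi>)) \<longlonglongrightarrow> 0"
        by (rule dual_on_complete [OF sub, of \<sigma>, OF \<sigma>])
      then show "\<exists>u\<in>T ` ?D. (\<lambda>n. N (s n - u)) \<longlonglongrightarrow> 0"
        by (intro bexI [of _ "T \<phi>"]) (auto simp: N)
    qed
  qed
  moreover have "\<Theta> ` T ` ?D = ?D" by (auto simp: \<Theta>T image_image)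
  moreover have "linear_map_on seq_scale seq_scale (T ` ?D) \<Theta>"
    by (auto simp: linear_map_on_def \<Theta>T dual_on_add dual_on_scale simp flip: T_add T_scale)
  \<comment> \<open>Both frame bounds and the bound of \<open>\<Theta>\<close> are 1, since
    \<open>N\<close> is the transported norm.\<close>
  ultimately have "retro_banach_frame sc Y y (T ` ?D) N \<Theta>"
    unfolding retro_banach_frame_def
    using y NT \<Theta>T
    by (auto simp: N_def T_def intro!: exI [of _ "1::real"])
  then show "\<exists>Z N \<Theta>. retro_banach_frame sc Y y Z N \<Theta>" by blast
qed

section \<open>Property I as a nonzero functional annihilating the differences\<close>

theorem proposition3p5:
  fixes sc :: "'k::real_or_complex \<Rightarrow> 'a::banach \<Rightarrow> 'a"
    and f :: "nat \<Rightarrow> 'a"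
    and fs :: "nat \<Rightarrow> 'a \<Rightarrow>\<^sub>L 'k"
  assumes "normed_scaling sc"
    and "infinite_dimensional sc"
    and "separable_space (euclidean :: 'a topology)"
    and "reconstruction_system sc f fs"
    and "(INF k. norm (f k)) > 0"
  shows "property_I sc f fs \<longleftrightarrow>
    \<not> (\<exists>Z N \<Theta>\<^sub>0. retro_banach_frame dual_scale (closed_span dual_scale fs)
                   (\<lambda>k. fs k - fs (Suc k)) Z N \<Theta>\<^sub>0)"
proof -
  let ?Y = "closed_span dual_scale fs"
  let ?D = "dual_on dual_scale ?Y"
  interpret normed_subspace "dual_scale :: 'k \<Rightarrow> ('a \<Rightarrow>\<^sub>L 'k) \<Rightarrow> ('a \<Rightarrow>\<^sub>L 'k)" ?Y
    by (intro normed_subspace.intro closed_span_subspace normed_scaling_dual_scale)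
  have fs: "fs k \<in> ?Y" for k by (rule closed_span_base [OF sc])
  have Y_dual: "?Y \<subseteq> dual_space sc"
    using assms(4) by (intro closed_span_subset_dual_space) (auto simp: reconstruction_system_def)
  have step: "fs k - fs (Suc k) \<in> ?Y" for k by (rule S.subspace_diff [OF Y fs fs])
  have apply_step: "\<phi> (fs k - fs (Suc k)) = \<phi> (fs k) - \<phi> (fs (Suc k))" if "\<phi> \<in> ?D" for \<phi> k
    using dual_onD(1) [OF that step fs, of k "Suc k"] by simp
  have "(\<exists>\<Psi>\<in>bidual_space sc. \<forall>k. \<Psi> (fs k) = 1) \<longleftrightarrow>
    (\<exists>\<phi>\<in>?D. (\<forall>k. \<phi> (fs k - fs (Suc k)) = 0) \<and> \<phi> \<noteq> 0)"
  proof
    assume "\<exists>\<Psi>\<in>bidual_space sc. \<forall>k. \<Psi> (fs k) = 1"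
    then obtain \<Psi> where \<Psi>: "\<Psi> \<in> dual_on dual_scale (dual_space sc)" and one: "\<And>k. \<Psi> (fs k) = 1"
      by (auto simp: bidual_space_def)
    \<comment> \<open>Restriction of \<open>\<Psi>\<close> to \<open>?Y\<close>; the value 0
      elsewhere is what the encoding \<open>dual_on\<close> demands.\<close>
    define \<phi> where "\<phi> = (\<lambda>v. if v \<in> ?Y then \<Psi> v else 0)"
    obtain C where C: "\<forall>v\<in>dual_space sc. norm (\<Psi> v) \<le> C * norm v" using dual_onD(4) [OF \<Psi>] ..
    have \<phi>: "\<phi> \<in> ?D"
      using Y_dual dual_onD(1,2) [OF \<Psi>] C S.subspace_add [OF Y] S.subspace_scale [OF Y]
      by (intro dual_onI [where C = C]) (auto simp: \<phi>_def subset_iff)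
    moreover have one': "\<phi> (fs k) = 1" for k by (simp add: \<phi>_def fs one)
    moreover from this have "\<phi> \<noteq> 0" by (metis zero_fun_apply zero_neq_one)
    ultimately show "\<exists>\<phi>\<in>?D. (\<forall>k. \<phi> (fs k - fs (Suc k)) = 0) \<and> \<phi> \<noteq> 0"
      by (intro bexI [of _ \<phi>]) (simp_all add: apply_step)
  next
    assume "\<exists>\<phi>\<in>?D. (\<forall>k. \<phi> (fs k - fs (Suc k)) = 0) \<and> \<phi> \<noteq> 0"
    then obtain \<phi> where \<phi>: "\<phi> \<in> ?D" and "\<phi> \<noteq> 0" and "\<And>k. \<phi> (fs (Suc k)) = \<phi> (fs k)"
      using apply_step by fastforce
    then have const: "\<phi> (fs k) = \<phi> (fs 0)" for k by (induction k) auto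
    \<comment> \<open>Were the constant 0, \<open>\<phi>\<close> would vanish on all
      \<open>fs k\<close> and hence on their closed span.\<close>
    then have c: "\<phi> (fs 0) \<noteq> 0"
      using dual_on_closed_span_eq_0 [OF sc \<phi>] \<open>\<phi> \<noteq> 0\<close> by metis
    define \<psi> where "\<psi> = seq_scale (inverse (\<phi> (fs 0))) \<phi>"
    have \<psi>: "\<psi> \<in> ?D" unfolding \<psi>_def by (rule dual_on_scale [OF \<phi>])
    have one: "\<psi> (fs k) = 1" for k
      using c by (simp add: \<psi>_def seq_scale_def const [of k])
    obtain g D where g: "linear_map_on dual_scale (*) UNIV g" "\<And>v. norm (g v) \<le> D * norm v"
      "\<And>v. v \<in> ?Y \<Longrightarrow> g v = \<psi> v"
    proof (rule Hahn_Banach [OF sc Y, of \<psi>])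
      show "linear_map_on dual_scale (*) ?Y \<psi>" using \<psi> by (simp add: dual_on_def)
      show "norm (\<psi> v) \<le> dual_norm_on ?Y \<psi> * norm v" for v by (rule norm_le_dual_norm_on [OF \<psi>])
    qed (use that in blast)
    \<comment> \<open>\<open>g\<close> lives on all bounded real-linear maps; an element of the
      bidual acts on the \<open>'k\<close>-linear ones and is set to 0 on the rest.\<close>
    define \<Psi> where "\<Psi> = (\<lambda>v. if v \<in> dual_space sc then g v else 0)"
    have "\<Psi> \<in> dual_on dual_scale (dual_space sc)"
      using g(1,2) S.subspace_add [OF subspace_dual_space] S.subspace_scale [OF subspace_dual_space]
      by (intro dual_onI [where C = D]) (auto simp: \<Psi>_def linear_map_on_def)
    moreover have "\<Psi> (fs k) = 1" for k
      using fs [of k] Y_dual by (auto simp: \<Psi>_def g(3) one)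
    ultimately show "\<exists>\<Psi>\<in>bidual_space sc. \<forall>k. \<Psi> (fs k) = 1"
      by (auto simp: bidual_space_def)
  qed
  \<comment> \<open>The other clauses of property I are hypotheses, so it amounts to the existence
    of \<open>\<Psi>\<close>, that is, to failure of injectivity.\<close>
  then show ?thesis
    using assms(4,5)
    by (auto simp: property_I_def
        retro_banach_frame_iff_injective [OF normed_subspace_axioms step])
qed

end
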